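(* Let $n\ge 1$ and fix $P_d\in\mathbb{S}_{++}^n$. Then the function $f:\mathbb{S}_{++}^n\to\mathbb{R}_+$, $f(X)=d_{\mathrm{BW}}^2(X,P_d)$, is strictly convex on $\mathbb{S}_{++}^n$; that is, for all $X,Y\in\mathbb{S}_{++}^n$ with $X\neq Y$ and all $t\in(0,1)$, $$t f(X)+(1-t)f(Y) > f(tX+(1-t)Y).$$
   Context: $\mathbb{S}_{+}^n$ and $\mathbb{S}_{++}^n$ denote the sets of real symmetric $n\times n$ positive semidefinite and positive definite matrices, respectively; $\mathbb{R}_+$ denotes the nonnegative reals. For $X,Y\in\mathbb{S}_+^n$, the Bures--Wasserstein distance is $$d_{\mathrm{BW}}(X,Y)=\left(\mathrm{tr}\left(X+Y-2\left(Y^{1/2}XY^{1/2}\right)^{1/2}\right)\right)^{1/2},$$ where $M^{1/2}$ denotes the unique positive semidefinite square root of $M\in\mathbb{S}_+^n$. *)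

theory Defs
  imports "HOL-Analysis.Analysis"
begin

definition psd_matrices :: "(real^'n^'n) set" where
  "psd_matrices = {A. transpose A = A \<and> (\<forall>x. 0 \<le> x \<bullet> (A *v x))}"

definition pd_matrices :: "(real^'n^'n) set" where
  "pd_matrices = {A. transpose A = A \<and> (\<forall>x. x \<noteq> 0 \<longrightarrow> 0 < x \<bullet> (A *v x))}"

text \<open>
  The description below is meaningful only for arguments in \<^const>\<open>psd_matrices\<close>, where the
  positive semidefinite square root exists and is unique.
\<close>

definition psd_sqrt :: "real^'n^'n \<Rightarrow> real^'n^'n" where
  "psd_sqrt M = (THE S. S \<in> psd_matrices \<and> S ** S = M)"

definition bures_wasserstein :: "real^'n^'n \<Rightarrow> real^'n^'n \<Rightarrow> real" where
  "bures_wasserstein X Y =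
     sqrt (trace (X + Y - 2 *\<^sub>R psd_sqrt (psd_sqrt Y ** X ** psd_sqrt Y)))"

end

theory Submission
  imports Defs
begin

text \<open>
  Put \<open>P = P\<^sub>d\<^sup>1\<^sup>/\<^sup>2\<close>. Expanding the trace gives
  \<open>f X = tr X + tr P\<^sub>d - 2 tr ((P X P)\<^sup>1\<^sup>/\<^sup>2)\<close>, an affine function of \<open>X\<close> minus twice
  \<open>tr ((P X P)\<^sup>1\<^sup>/\<^sup>2)\<close>. The map \<open>X \<mapsto> P X P\<close> is linear, injective and preserves positive
  definiteness, so strict convexity of \<open>f\<close> reduces to strict concavity of
  \<open>A \<mapsto> tr (A\<^sup>1\<^sup>/\<^sup>2)\<close> on positive definite matrices
  (\<open>trace_psd_sqrt_strictly_concave\<close>).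

  For the latter, let \<open>S\<close>, \<open>T\<close>, \<open>R\<close> be the roots of \<open>A\<close>, \<open>B\<close> and \<open>t A + (1 - t) B\<close>, and let
  \<open>M = t S + (1 - t) T\<close>. Then \<open>R\<^sup>2 - M\<^sup>2 = t (1 - t) (S - T)\<^sup>2\<close>, the matrix form of the strict
  convexity of squaring. To pass from squares to \<open>E = R - M\<close> itself although \<open>R\<close> and \<open>M\<close> need
  not commute, note that \<open>E\<close> solves the Lyapunov equation \<open>E K + K E = 2 (R\<^sup>2 - M\<^sup>2)\<close> with
  \<open>K = R + M\<close> positive definite. Multiplying by \<open>K\<^sup>-\<^sup>1\<close> and taking traces yields
  \<open>tr E = t (1 - t) tr ((S - T) K\<^sup>-\<^sup>1 (S - T))\<close>, which is positive when \<open>S \<noteq> T\<close>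
  (\<open>lyapunov_trace_pos\<close>).

  Two facts make the expansion of \<open>f\<close> legitimate. The square root of a positive definite
  matrix exists and is unique; existence comes from the contraction principle
  (\<open>selfadjoint_sqrt_fixed_point\<close>), which avoids diagonalisation, and uniqueness from a trace
  argument of Lyapunov type (\<open>psd_sqrt_unique\<close>). And the trace under the outer square root
  in the definition of the distance is nonnegative (\<open>bures_trace_nonneg\<close>), being a squared
  Frobenius norm; since \<^const>\<open>sqrt\<close> extends to negative reals as an odd function, squaring it
  recovers only the absolute value of its argument.
\<close>

section \<open>Matrix algebra, transposes and traces\<close>

lemma bounded_bilinear_matrix_mult:
  "bounded_bilinear ((**) :: real^'m^'n \<Rightarrow> real^'k^'m \<Rightarrow> real^'k^'n)"
proof -
  have "bilinear ((**) :: real^'m^'n \<Rightarrow> real^'k^'m \<Rightarrow> real^'k^'n)"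
    unfolding bilinear_def linear_iff
    by (auto simp: vec_eq_iff matrix_matrix_mult_def sum.distrib algebra_simps sum_distrib_left)
  then show ?thesis
    by (simp add: bilinear_conv_bounded_bilinear)
qed

interpretation mm: bounded_bilinear "(**) :: real^'m^'n \<Rightarrow> real^'k^'m \<Rightarrow> real^'k^'n"
  by (rule bounded_bilinear_matrix_mult)

lemma trace_scaleR: "trace (c *\<^sub>R A) = c * trace A" for A :: "real^'n^'n"
  by (simp add: trace_def sum_distrib_left)

lemma
  fixes A B :: "real^'m^'n"
  shows transpose_add: "transpose (A + B) = transpose A + transpose B"
    and transpose_diff: "transpose (A - B) = transpose A - transpose B"
  by (simp_all add: transpose_def vec_eq_iff)

lemma inner_transpose: "x \<bullet> (A *v y) = (transpose A *v x) \<bullet> y"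
  for A :: "real^'m^'n"
  by (simp add: dot_lmul_matrix)

lemma symmetric_inner: "transpose A = A \<Longrightarrow> x \<bullet> (A *v y) = (A *v x) \<bullet> y"
  for A :: "real^'n^'n"
  using inner_transpose[of x A y] by metis

lemma symmetric_matrixI:
  fixes A :: "real^'n^'n"
  assumes "\<And>x y. x \<bullet> (A *v y) = (A *v x) \<bullet> y"
  shows "transpose A = A"
proof -
  have "(transpose A *v x - A *v x) \<bullet> y = 0" for x y
    using assms[of x y] inner_transpose[of x A y] by (simp add: inner_diff_left)
  then have "transpose A *v x - A *v x = 0" for x
    using inner_eq_zero_iff by blast
  then show ?thesis
    unfolding matrix_eq by (metis eq_iff_diff_eq_0)
qed

section \<open>Positive definite matrices\<close>

lemma pd_matricesD:
  assumes "A \<in> pd_matrices"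
  shows "transpose A = A" "x \<noteq> 0 \<Longrightarrow> 0 < x \<bullet> (A *v x)" "0 \<le> x \<bullet> (A *v x)"
  using assms unfolding pd_matrices_def by (auto, metis inner_zero_left less_eq_real_def)

lemma pd_imp_psd: "A \<in> pd_matrices \<Longrightarrow> A \<in> psd_matrices"
  using pd_matricesD[of A] by (auto simp: psd_matrices_def)

lemma psd_matricesD:
  assumes "A \<in> psd_matrices"
  shows "transpose A = A" "0 \<le> x \<bullet> (A *v x)"
  using assms unfolding psd_matrices_def by auto

lemma pd_scaleR: "A \<in> pd_matrices \<Longrightarrow> 0 < c \<Longrightarrow> c *\<^sub>R A \<in> pd_matrices"
  by (auto simp: pd_matrices_def transpose_scalar scaleR_matrix_vector_assoc[symmetric])

lemma pd_add: "A \<in> pd_matrices \<Longrightarrow> B \<in> pd_matrices \<Longrightarrow> A + B \<in> pd_matrices"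
  by (auto simp: pd_matrices_def transpose_add matrix_vector_mult_add_rdistrib inner_add_right
      add_pos_pos)

lemma pd_inverse:
  assumes "A \<in> pd_matrices"
  obtains B where "B \<in> pd_matrices" "A ** B = mat 1" "B ** A = mat 1"
proof -
  have "\<forall>x. A *v x = 0 \<longrightarrow> x = 0"
    using pd_matricesD(2)[OF assms] by (metis inner_zero_right less_irrefl)
  then obtain B where BA: "B ** A = mat 1"
    using matrix_left_invertible_ker[of A] by auto
  then have AB: "A ** B = mat 1"
    by (metis matrix_left_right_inverse)
  have "transpose B ** A = mat 1"
    using arg_cong[OF AB, of transpose] pd_matricesD(1)[OF assms]
    by (simp add: matrix_transpose_mul)
  then have sym: "transpose B = B"
    by (metis AB matrix_mul_assoc matrix_mul_lid matrix_mul_rid)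
  have "0 < x \<bullet> (B *v x)" if "x \<noteq> 0" for x
  proof -
    have x: "x = A *v (B *v x)"
      by (simp add: matrix_vector_mul_assoc AB)
    then have "B *v x \<noteq> 0"
      using that by auto
    from pd_matricesD(2)[OF assms this] show ?thesis
      using x by (metis inner_commute)
  qed
  with sym have "B \<in> pd_matrices"
    by (auto simp: pd_matrices_def)
  with AB BA that show ?thesis by blast
qed

lemma pd_congruence:
  assumes "A \<in> pd_matrices" "P \<in> pd_matrices"
  shows "P ** A ** P \<in> pd_matrices"
proof -
  have "0 < x \<bullet> ((P ** A ** P) *v x)" if "x \<noteq> 0" for x
  proof -
    have "P *v x \<noteq> 0"
      using pd_matricesD(2)[OF assms(2) that] by auto
    from pd_matricesD(2)[OF assms(1) this] show ?thesis
      using symmetric_inner[OF pd_matricesD(1)[OF assms(2)], of x]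
      by (simp add: matrix_vector_mul_assoc[symmetric])
  qed
  then show ?thesis
    using assms[THEN pd_matricesD(1)]
    by (simp add: pd_matrices_def matrix_transpose_mul matrix_mul_assoc)
qed

text \<open>
  This identity converts definiteness of \<open>A\<close> into inequalities between traces: the right-hand
  side is a sum of values of the quadratic form of \<open>A\<close>.
\<close>

lemma trace_congruence:
  fixes A :: "real^'n^'n" and E :: "real^'m^'n"
  shows "trace (transpose E ** A ** E) = (\<Sum>j\<in>UNIV. column j E \<bullet> (A *v column j E))"
  unfolding matrix_mul_assoc[symmetric]
  by (simp add: trace_def matrix_matrix_mult_def transpose_def column_def inner_vec_def
      matrix_vector_mult_def)

lemma trace_congruence_pos:
  fixes E :: "real^'m^'n"
  assumes "A \<in> pd_matrices" "E \<noteq> 0"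
  shows "0 < trace (transpose E ** A ** E)"
proof -
  obtain j where "column j E \<noteq> 0"
    using assms(2) by (auto simp: vec_eq_iff column_def)
  then show ?thesis
    unfolding trace_congruence
    using pd_matricesD[OF assms(1)] by (intro sum_pos2[of _ j]) auto
qed

lemma trace_congruence_nonneg:
  fixes E :: "real^'m^'n"
  assumes "A \<in> psd_matrices"
  shows "0 \<le> trace (transpose E ** A ** E)"
  unfolding trace_congruence using psd_matricesD(2)[OF assms] by (simp add: sum_nonneg)

section \<open>The square root of a positive definite matrix\<close>

text \<open>
  The conclusion says \<open>(1 - Y)\<^sup>2 = 1 - B\<close>, so \<open>1 - Y\<close> is a square root of \<open>1 - B\<close>. The map
  \<open>Y \<mapsto> (B + Y\<^sup>2) / 2\<close> preserves the closed set of self-adjoint operators of norm at most \<open>q\<close>,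
  and is a \<open>q\<close>-contraction there because \<open>Y\<^sup>2 - Z\<^sup>2 = Y (Y - Z) + (Y - Z) Z\<close> holds without
  any commutativity.
\<close>

lemma selfadjoint_sqrt_fixed_point:
  fixes B :: "'a::{real_inner,banach} \<Rightarrow>\<^sub>L 'a"
  assumes sym: "\<And>x y. x \<bullet> B y = B x \<bullet> y" and B: "norm B \<le> q" and q: "q < 1"
  obtains Y :: "'a \<Rightarrow>\<^sub>L 'a" where "\<And>x y. x \<bullet> Y y = Y x \<bullet> y" "norm Y \<le> q"
    "\<And>x. 2 *\<^sub>R Y x = B x + Y (Y x)"
proof -
  define S where "S = {Y :: 'a \<Rightarrow>\<^sub>L 'a. norm Y \<le> q \<and>
      (\<forall>x y. x \<bullet> blinfun_apply Y y = blinfun_apply Y x \<bullet> y)}"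
  define f where "f Y = (1/2) *\<^sub>R (B + (Y o\<^sub>L Y))" for Y :: "'a \<Rightarrow>\<^sub>L 'a"
  have q0: "0 \<le> q"
    using B norm_ge_zero order_trans by blast
  have "closed S"
    unfolding S_def
    by (intro closed_Collect_conj closed_Collect_all closed_Collect_le closed_Collect_eq
        continuous_intros)
  then have "complete S"
    by (simp add: complete_eq_closed)
  moreover have "0 \<in> S"
    using q0 by (simp add: S_def)
  moreover have "f ` S \<subseteq> S"
  proof safe
    fix Y assume Y: "Y \<in> S"
    have "norm (Y o\<^sub>L Y) \<le> norm Y * norm Y"
      by (rule norm_blinfun_compose)
    also have "\<dots> \<le> q * 1"
      using Y q q0 by (intro mult_mono) (auto simp: S_def)
    finally have "norm (f Y) \<le> q"
      using B norm_triangle_ineq[of B "Y o\<^sub>L Y"] by (simp add: f_def)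
    then show "f Y \<in> S"
      using Y sym by (simp add: S_def f_def blinfun.bilinear_simps inner_simps)
  qed
  moreover have "dist (f Y) (f Z) \<le> q * dist Y Z" if "Y \<in> S" "Z \<in> S" for Y Z
  proof -
    have eq: "f Y - f Z = (1/2) *\<^sub>R ((Y o\<^sub>L (Y - Z)) + ((Y - Z) o\<^sub>L Z))"
      by (rule blinfun_eqI) (simp add: f_def blinfun.bilinear_simps algebra_simps)
    have "norm (Y o\<^sub>L (Y - Z)) \<le> q * norm (Y - Z)"
      using that by (intro norm_blinfun_compose[THEN order_trans] mult_right_mono) (auto simp: S_def)
    moreover have "norm ((Y - Z) o\<^sub>L Z) \<le> norm (Y - Z) * q"
      using that by (intro norm_blinfun_compose[THEN order_trans] mult_left_mono) (auto simp: S_def)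
    ultimately show ?thesis
      using norm_triangle_ineq[of "Y o\<^sub>L (Y - Z)" "(Y - Z) o\<^sub>L Z"]
      by (simp add: dist_norm eq mult.commute[of q])
  qed
  ultimately obtain Y where Y: "Y \<in> S" "f Y = Y"
    using Banach_fix[of S q f] q q0 by blast
  have "2 *\<^sub>R Y x = B x + Y (Y x)" for x
    using arg_cong[OF Y(2), of "\<lambda>Z. 2 *\<^sub>R blinfun_apply Z x"]
    by (simp add: f_def blinfun.bilinear_simps)
  with Y that show ?thesis
    by (auto simp: S_def)
qed

lemma pd_coercive:
  fixes A :: "real^'n^'n"
  assumes "A \<in> pd_matrices"
  obtains m where "0 < m" "\<And>x. m * (norm x)\<^sup>2 \<le> x \<bullet> (A *v x)"
proof -
  have "compact (sphere (0::real^'n) 1)" "sphere (0::real^'n) 1 \<noteq> {}"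
    by auto
  moreover have "continuous_on (sphere 0 1) (\<lambda>x. x \<bullet> (A *v x))"
    by (intro continuous_intros)
  ultimately obtain u where u: "u \<in> sphere 0 1"
    and min: "\<And>x. x \<in> sphere 0 1 \<Longrightarrow> u \<bullet> (A *v u) \<le> x \<bullet> (A *v x)"
    using continuous_attains_inf by metis
  show ?thesis
  proof (rule that[of "u \<bullet> (A *v u)"])
    show "0 < u \<bullet> (A *v u)"
      using u by (intro pd_matricesD(2)[OF assms]) auto
    show "u \<bullet> (A *v u) * (norm x)\<^sup>2 \<le> x \<bullet> (A *v x)" for x
    proof (cases "x = 0")
      case False
      have "u \<bullet> (A *v u) \<le> sgn x \<bullet> (A *v sgn x)"
        using False by (intro min) (simp add: norm_sgn)
      also have "\<dots> = x \<bullet> (A *v x) / (norm x)\<^sup>2"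
        by (simp add: sgn_div_norm matrix_vector_mult_scaleR power2_eq_square field_simps)
      finally show ?thesis
        using False by (simp add: field_simps)
    qed simp
  qed
qed

text \<open>
  After division by a large constant \<open>c\<close>, the matrix has the form \<open>1 - B\<close> with \<open>norm B < 1\<close>, and the
  fixed point \<open>Y\<close> for \<open>B\<close> gives the root \<open>c\<^sup>1\<^sup>/\<^sup>2 (1 - Y)\<close>, which is positive definite
  because \<open>norm Y < 1\<close>.
\<close>

lemma pd_sqrt_exists:
  fixes A :: "real^'n^'n"
  assumes "A \<in> pd_matrices"
  obtains S where "S \<in> pd_matrices" "S ** S = A"
proof -
  note sym = symmetric_inner[OF pd_matricesD(1)[OF assms]]
  obtain m where m: "0 < m" "\<And>x. m * (norm x)\<^sup>2 \<le> x \<bullet> (A *v x)"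
    using pd_coercive[OF assms] by blast
  \<comment> \<open>The maximum with \<open>m\<close> makes \<open>L\<close> positive and \<open>m / L\<close> at most 1 without further case distinctions.\<close>
  define L where "L = max m (onorm ((*v) A))"
  have L: "norm (A *v x) \<le> L * norm x" for x
    unfolding L_def using onorm[OF matrix_vector_mul_bounded_linear[of A], of x]
    by (meson max.cobounded2 mult_right_mono norm_ge_zero order_trans)
  have L0: "0 < L" "m \<le> L"
    using m by (auto simp: L_def)
  \<comment> \<open>Since \<open>\<bar>x - A x / c\<bar>\<^sup>2 \<le> (1 - 2 m / c + L\<^sup>2 / c\<^sup>2) \<bar>x\<bar>\<^sup>2\<close>, the best choice is \<open>c = L\<^sup>2 / m\<close>;
    the factor is then \<open>1 - m\<^sup>2 / L\<^sup>2\<close>, the square of the \<open>q\<close> below.\<close>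
  define c where "c = L\<^sup>2 / m"
  have c: "0 < c" using m L0 by (simp add: c_def)
  define q where "q = sqrt (1 - m\<^sup>2 / L\<^sup>2)"
  have q1: "q < 1"
    using m L0 by (simp add: q_def)
  have ratio: "m\<^sup>2 / L\<^sup>2 \<le> 1"
    using m L0 by (simp add: power_mono)
  have q2: "q\<^sup>2 = 1 - m\<^sup>2 / L\<^sup>2" "0 \<le> q"
    using ratio by (simp_all add: q_def)
  define B where "B = Blinfun (\<lambda>x. x - (1/c) *\<^sub>R (A *v x))"
  have B: "blinfun_apply B x = x - (1/c) *\<^sub>R (A *v x)" for x
    unfolding B_def by (subst bounded_linear_Blinfun_apply) (auto intro!: bounded_linear_intros)
  have "norm B \<le> q"
  proof (rule norm_blinfun_bound)
    fix x
    have "(norm (B x))\<^sup>2 = (norm x)\<^sup>2 - 2 / c * (x \<bullet> (A *v x)) + (norm (A *v x))\<^sup>2 / c\<^sup>2"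
      unfolding B power2_norm_eq_inner
      by (simp add: inner_diff_left inner_diff_right inner_commute power2_eq_square algebra_simps)
    also have "\<dots> \<le> (norm x)\<^sup>2 - 2 / c * (m * (norm x)\<^sup>2) + (L * norm x)\<^sup>2 / c\<^sup>2"
      using c m(2)[of x] L[of x]
      by (intro add_mono diff_mono mult_left_mono divide_right_mono power_mono) auto
    also have "\<dots> = (q * norm x)\<^sup>2"
      unfolding power_mult_distrib q2 c_def using m L0
      by (simp add: field_simps power2_eq_square)
    finally show "norm (B x) \<le> q * norm x"
      using q2 by (meson mult_nonneg_nonneg norm_ge_zero power2_le_imp_le)
  qed (fact q2)
  moreover have "x \<bullet> B y = B x \<bullet> y" for x y
    by (simp add: B inner_diff_left inner_diff_right sym)
  ultimately obtain Y :: "(real^'n) \<Rightarrow>\<^sub>L (real^'n)" where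
    Y: "\<And>x y. x \<bullet> Y y = Y x \<bullet> y" "norm Y \<le> q"
    "\<And>x. 2 *\<^sub>R Y x = B x + Y (Y x)"
    using selfadjoint_sqrt_fixed_point[of B q] q1 by blast
  define S where "S = matrix (\<lambda>x. sqrt c *\<^sub>R (x - Y x))"
  have S: "S *v x = sqrt c *\<^sub>R (x - Y x)" for x
    unfolding S_def
    by (rule matrix_works, subst linear_matrix_vector_mul_eq)
      (intro bounded_linear.linear bounded_linear_intros)
  have "(S ** S) *v x = A *v x" for x
  proof -
    have "(S ** S) *v x = c *\<^sub>R (x - (2 *\<^sub>R Y x - Y (Y x)))"
      using c by (simp add: matrix_vector_mul_assoc[symmetric] S blinfun.bilinear_simps
          scaleR_diff_right scaleR_2 scaleR_add_right)
    also have "\<dots> = A *v x"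
      using c by (simp add: Y(3) B)
    finally show ?thesis .
  qed
  then have "S ** S = A"
    by (simp add: matrix_eq)
  moreover have "transpose S = S"
    by (rule symmetric_matrixI) (simp add: S inner_diff_left inner_diff_right Y(1))
  moreover have "0 < x \<bullet> (S *v x)" if "x \<noteq> 0" for x
  proof -
    have "x \<bullet> Y x \<le> norm x * norm (Y x)"
      by (rule norm_cauchy_schwarz)
    also have "\<dots> \<le> norm x * (q * norm x)"
      using norm_blinfun[of Y x] Y(2)
      by (meson mult_left_mono mult_right_mono norm_ge_zero order_trans)
    also have "\<dots> < norm x * (1 * norm x)"
      using that q1 by (intro mult_strict_left_mono mult_strict_right_mono) auto
    finally show ?thesis
      using c by (simp add: S inner_diff_right dot_square_norm power2_eq_square)
  qed
  ultimately show ?thesis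
    using that by (auto simp: pd_matrices_def)
qed

text \<open>
  The difference \<open>E = S - T\<close> satisfies \<open>E S + T E = S\<^sup>2 - T\<^sup>2 = 0\<close>. Multiplying by \<open>E\<close> and taking
  traces gives \<open>tr (E S E) + tr (E T E) = 0\<close> with both summands nonnegative, and the second
  one positive unless \<open>E = 0\<close>.
\<close>

lemma psd_sqrt_unique:
  assumes "S \<in> psd_matrices" "T \<in> pd_matrices" "S ** S = T ** T"
  shows "S = T"
proof (rule ccontr)
  assume "S \<noteq> T"
  define E where "E = S - T"
  have sym: "transpose E = E"
    using psd_matricesD(1)[OF assms(1)] pd_matricesD(1)[OF assms(2)]
    by (simp add: E_def transpose_diff)
  have "E ** S + T ** E = 0"
    using assms(3) by (simp add: E_def mm.diff_left mm.diff_right)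
  then have "trace ((E ** S + T ** E) ** E) = 0"
    by (simp add: trace_def)
  then have "trace (E ** S ** E) + trace (E ** T ** E) = 0"
    by (simp add: mm.add_left trace_add trace_mul_sym[of "T ** E"] matrix_mul_assoc)
  moreover have "0 < trace (E ** T ** E)"
    using trace_congruence_pos[OF assms(2), of E] \<open>S \<noteq> T\<close> sym by (simp add: E_def)
  moreover have "0 \<le> trace (E ** S ** E)"
    using trace_congruence_nonneg[OF assms(1), of E] sym by simp
  ultimately show False by simp
qed

lemma psd_sqrt_pd:
  assumes "A \<in> pd_matrices"
  shows "psd_sqrt A \<in> pd_matrices" "psd_sqrt A ** psd_sqrt A = A"
proof -
  obtain S where S: "S \<in> pd_matrices" "S ** S = A"
    using pd_sqrt_exists[OF assms] .
  have "psd_sqrt A = S"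
    unfolding psd_sqrt_def
  proof (rule the_equality)
    show "S \<in> psd_matrices \<and> S ** S = A"
      using S pd_imp_psd by blast
    show "T = S" if "T \<in> psd_matrices \<and> T ** T = A" for T
      using that S psd_sqrt_unique[of T S] by simp
  qed
  with S show "psd_sqrt A \<in> pd_matrices" "psd_sqrt A ** psd_sqrt A = A"
    by auto
qed

section \<open>Strict concavity of the trace of the square root\<close>

text \<open>
  Multiplication by \<open>K\<^sup>-\<^sup>1\<close> turns the left-hand side into \<open>K\<^sup>-\<^sup>1 E K + E\<close>, whose trace is
  \<open>2 tr E\<close> by cyclicity, and the right-hand side into a matrix with the trace of
  \<open>c F K\<^sup>-\<^sup>1 F\<close>, a congruence of the positive definite matrix \<open>K\<^sup>-\<^sup>1\<close>.
\<close>

lemma lyapunov_trace_pos: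
  assumes "K \<in> pd_matrices" "E ** K + K ** E = c *\<^sub>R (F ** F)" "0 < c" "transpose F = F" "F \<noteq> 0"
  shows "0 < trace E"
proof -
  obtain N where N: "N \<in> pd_matrices" "K ** N = mat 1" "N ** K = mat 1"
    using pd_inverse[OF assms(1)] .
  have "trace (N ** (E ** K)) = trace E" "trace (N ** (K ** E)) = trace E"
    using N(2,3) by (metis trace_mul_sym matrix_mul_assoc matrix_mul_rid,
        metis matrix_mul_assoc matrix_mul_lid)
  then have "2 * trace E = trace (N ** (E ** K + K ** E))"
    by (simp add: mm.add_right trace_add)
  also have "\<dots> = c * trace (transpose F ** N ** F)"
    unfolding assms(2) assms(4)
    by (simp add: mm.scaleR_right trace_scaleR matrix_mul_assoc trace_mul_sym[of "N ** F"])
  also have "\<dots> > 0"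
    using trace_congruence_pos[OF N(1) assms(5)] assms(3) by simp
  finally show ?thesis by simp
qed

lemma trace_psd_sqrt_strictly_concave:
  assumes A: "A \<in> pd_matrices" and B: "B \<in> pd_matrices" and "A \<noteq> B" and t: "0 < t" "t < 1"
  shows "t * trace (psd_sqrt A) + (1 - t) * trace (psd_sqrt B)
    < trace (psd_sqrt (t *\<^sub>R A + (1 - t) *\<^sub>R B))"
proof -
  define S T R where "S = psd_sqrt A" and "T = psd_sqrt B"
    and "R = psd_sqrt (t *\<^sub>R A + (1 - t) *\<^sub>R B)"
  have C: "t *\<^sub>R A + (1 - t) *\<^sub>R B \<in> pd_matrices"
    using A B t by (intro pd_add pd_scaleR) auto
  note S = psd_sqrt_pd[OF A, folded S_def] and T = psd_sqrt_pd[OF B, folded T_def]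
    and R = psd_sqrt_pd[OF C, folded R_def]
  define M where "M = t *\<^sub>R S + (1 - t) *\<^sub>R T"
  have M: "M \<in> pd_matrices"
    unfolding M_def using S(1) T(1) t by (intro pd_add pd_scaleR) auto
  \<comment> \<open>The gap in the convexity of squaring, valid for noncommuting \<open>S\<close> and \<open>T\<close>.\<close>
  have "R ** R - M ** M = (t * (1 - t)) *\<^sub>R ((S - T) ** (S - T))"
    unfolding R(2) M_def S(2)[symmetric] T(2)[symmetric]
    by (simp add: mm.add_left mm.add_right mm.diff_left mm.diff_right mm.scaleR_left
        mm.scaleR_right algebra_simps)
  \<comment> \<open>Symmetrising \<open>(R - M) (R + M)\<close> cancels the commutator of \<open>R\<close> and \<open>M\<close>.\<close>
  moreover have "(R - M) ** (R + M) + (R + M) ** (R - M) = 2 *\<^sub>R (R ** R - M ** M)"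
    by (simp add: mm.add_left mm.add_right mm.diff_left mm.diff_right scaleR_2)
  ultimately have "(R - M) ** (R + M) + (R + M) ** (R - M)
      = (2 * (t * (1 - t))) *\<^sub>R ((S - T) ** (S - T))"
    by simp
  moreover have "S - T \<noteq> 0"
    using S(2) T(2) \<open>A \<noteq> B\<close> by auto
  moreover have "transpose (S - T) = S - T"
    using pd_matricesD(1)[OF S(1)] pd_matricesD(1)[OF T(1)] by (simp add: transpose_diff)
  ultimately have "0 < trace (R - M)"
    using lyapunov_trace_pos[OF pd_add[OF R(1) M]] t by simp
  then show ?thesis
    by (simp add: M_def R_def S_def T_def trace_sub trace_add trace_scaleR)
qed

section \<open>The squared Bures--Wasserstein distance\<close>

text \<open>
  With \<open>P = Y\<^sup>1\<^sup>/\<^sup>2\<close> and \<open>R = (P X P)\<^sup>1\<^sup>/\<^sup>2\<close>, the matrix \<open>Z = R P\<^sup>-\<^sup>1\<close> is another factor of \<open>X\<close>: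
  its transpose times itself is \<open>P\<^sup>-\<^sup>1 R\<^sup>2 P\<^sup>-\<^sup>1 = X\<close>. The trace in question is the squared
  Frobenius norm of \<open>Z - P\<close>, because both cross terms have trace \<open>tr R\<close>.
\<close>

lemma bures_trace_nonneg:
  assumes X: "X \<in> pd_matrices" and Y: "Y \<in> pd_matrices"
  shows "0 \<le> trace (X + Y - 2 *\<^sub>R psd_sqrt (psd_sqrt Y ** X ** psd_sqrt Y))"
proof -
  define P R where "P = psd_sqrt Y" and "R = psd_sqrt (P ** X ** P)"
  note P = psd_sqrt_pd[OF Y, folded P_def]
  note R = psd_sqrt_pd[OF pd_congruence[OF X P(1)], folded R_def]
  obtain N where N: "N \<in> pd_matrices" "P ** N = mat 1" "N ** P = mat 1"
    using pd_inverse[OF P(1)] .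
  note sym = P(1)[THEN pd_matricesD(1)] R(1)[THEN pd_matricesD(1)] N(1)[THEN pd_matricesD(1)]
  define E where "E = R ** N - P"
  have "N ** R ** (R ** N) = (N ** P) ** X ** (P ** N)"
    using R(2) by (metis matrix_mul_assoc)
  then have X': "N ** R ** (R ** N) = X"
    by (simp add: N)
  have RN: "trace (N ** R ** P) = trace R" "trace (P ** (R ** N)) = trace R"
    using N(2,3) by (metis trace_mul_sym matrix_mul_assoc matrix_mul_lid,
        metis trace_mul_sym matrix_mul_assoc matrix_mul_rid)
  have "transpose E ** E = X + Y - (N ** R ** P + P ** (R ** N))"
    unfolding E_def transpose_diff matrix_transpose_mul sym mm.diff_left mm.diff_right X' P(2)
    by simp
  then have "trace (transpose E ** E) = trace (X + Y - 2 *\<^sub>R R)"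
    by (simp add: trace_add trace_sub trace_scaleR RN)
  moreover have "0 \<le> trace (transpose E ** E)"
    by (simp add: trace_def matrix_mult_transpose_dot_column sum_nonneg)
  ultimately show ?thesis
    by (simp add: R_def P_def)
qed

lemma bures_wasserstein_squared:
  assumes "X \<in> pd_matrices" "Y \<in> pd_matrices"
  shows "(bures_wasserstein X Y)\<^sup>2
    = trace X + trace Y - 2 * trace (psd_sqrt (psd_sqrt Y ** X ** psd_sqrt Y))"
  using bures_trace_nonneg[OF assms]
  by (simp add: bures_wasserstein_def trace_add trace_sub trace_scaleR)

theorem theorem1:
  fixes P\<^sub>d :: "real^'n^'n"
  assumes "P\<^sub>d \<in> pd_matrices"
  shows "(\<lambda>X. (bures_wasserstein X P\<^sub>d)\<^sup>2) \<in> pd_matrices \<rightarrow> {0..} \<and>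
    (\<forall>X \<in> pd_matrices. \<forall>Y \<in> pd_matrices. \<forall>t \<in> {0<..<1}. X \<noteq> Y \<longrightarrow>
       t * (bures_wasserstein X P\<^sub>d)\<^sup>2 + (1 - t) * (bures_wasserstein Y P\<^sub>d)\<^sup>2
         > (bures_wasserstein (t *\<^sub>R X + (1 - t) *\<^sub>R Y) P\<^sub>d)\<^sup>2)"
proof (intro conjI ballI impI)
  show "(\<lambda>X. (bures_wasserstein X P\<^sub>d)\<^sup>2) \<in> pd_matrices \<rightarrow> {0..}"
    by auto
next
  fix X Y :: "real^'n^'n" and t :: real
  assume X: "X \<in> pd_matrices" and Y: "Y \<in> pd_matrices" and "t \<in> {0<..<1}" and "X \<noteq> Y"
  then have t: "0 < t" "t < 1" by auto
  define P where "P = psd_sqrt P\<^sub>d"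
  have P: "P \<in> pd_matrices"
    using psd_sqrt_pd(1)[OF assms] by (simp add: P_def)
  have "P ** X ** P \<noteq> P ** Y ** P"
  proof
    assume eq: "P ** X ** P = P ** Y ** P"
    obtain N where "P ** N = mat 1" "N ** P = mat 1"
      using pd_inverse[OF P] .
    then show False
      using eq \<open>X \<noteq> Y\<close> by (metis matrix_mul_assoc matrix_mul_lid matrix_mul_rid)
  qed
  then have "t * trace (psd_sqrt (P ** X ** P)) + (1 - t) * trace (psd_sqrt (P ** Y ** P))
      < trace (psd_sqrt (t *\<^sub>R (P ** X ** P) + (1 - t) *\<^sub>R (P ** Y ** P)))"
    using trace_psd_sqrt_strictly_concave X Y P t pd_congruence by blast
  moreover have "t *\<^sub>R (P ** X ** P) + (1 - t) *\<^sub>R (P ** Y ** P)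
      = P ** (t *\<^sub>R X + (1 - t) *\<^sub>R Y) ** P"
    by (simp add: mm.add_left mm.add_right mm.scaleR_left mm.scaleR_right)
  moreover have "t *\<^sub>R X + (1 - t) *\<^sub>R Y \<in> pd_matrices"
    using X Y t by (intro pd_add pd_scaleR) auto
  ultimately show "(bures_wasserstein (t *\<^sub>R X + (1 - t) *\<^sub>R Y) P\<^sub>d)\<^sup>2
      < t * (bures_wasserstein X P\<^sub>d)\<^sup>2 + (1 - t) * (bures_wasserstein Y P\<^sub>d)\<^sup>2"
    using X Y assms
    by (simp only: bures_wasserstein_squared trace_add trace_scaleR flip: P_def)
      (simp add: algebra_simps)
qed

end
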